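(* Let $B_1,B_2,\dots,B_k\in\mathbb{R}^{n\times n}$ be nonsingular bidiagonal matrices (each of which may be upper or lower bidiagonal) such that either all the $B_i$ are nonnegative or all the $B_i$ have a checkerboard sign pattern. Then, with $e=[1,1,\dots,1]^T\in\mathbb{R}^n$, $$\|B_1B_2\cdots B_k\|_\infty = \bigl\|\,|B_1|\,|B_2|\cdots|B_k|\,e\,\bigr\|_\infty,$$ $$\|B_k^{-1}B_{k-1}^{-1}\cdots B_1^{-1}\|_\infty = \bigl\|M(B_k)^{-1}M(B_{k-1})^{-1}\cdots M(B_1)^{-1}e\bigr\|_\infty .$$ Consequently, evaluating these right-hand sides by $k$ bidiagonal matrix--vector products and $k$ bidiagonal substitutions, the condition number $\kappa_\infty(B_1B_2\cdots B_k)$ can be computed exactly (in exact arithmetic), given the factors $B_i$ and without forming the product, in at most $6kn$ flops.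
   Context: For a nonsingular matrix $X$, $\kappa_\infty(X)=\|X\|_\infty\|X^{-1}\|_\infty$, where $\|\cdot\|_\infty$ is the matrix norm subordinate to the vector $\infty$-norm (maximum absolute row sum). For $A=(a_{ij})$, $|A|=(|a_{ij}|)$. The comparison matrix $M(A)$ of $A\in\mathbb{C}^{n\times n}$ is defined by $(M(A))_{ii}=|a_{ii}|$ and $(M(A))_{ij}=-|a_{ij}|$ for $i\ne j$. A matrix $A\in\mathbb{R}^{n\times n}$ has a checkerboard sign pattern if $A=\Sigma|A|\Sigma$ or $A=-\Sigma|A|\Sigma$, where $\Sigma=\operatorname{diag}(1,-1,1,\dots,(-1)^{n-1})$ (the sign may differ between different matrices). A matrix is nonnegative if all its entries are nonnegative. A matrix is upper bidiagonal if its only possibly nonzero entries are in positions $(i,i)$ and $(i,i+1)$; it is lower bidiagonal if its transpose is upper bidiagonal. A flop is one scalar addition, subtraction, multiplication or division; taking absolute values, sign changes and comparisons are not counted. *)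

theory Defs
  imports
    "Jordan_Normal_Form.Gauss_Jordan_Elimination"
    "HOL-Library.State_Monad"
    Complex_Main
begin

section \<open>Matrices\<close>

text \<open>Indices run from \<open>0\<close> to \<open>n - 1\<close>.\<close>

definition vec_norm_inf :: "real vec \<Rightarrow> real" where
  "vec_norm_inf x = Max ((\<lambda>i. \<bar>x $ i\<bar>) ` {..<dim_vec x})"

definition mat_norm_inf :: "real mat \<Rightarrow> real" where
  "mat_norm_inf A =
    (SUP x \<in> {x \<in> carrier_vec (dim_col A). x \<noteq> 0\<^sub>v (dim_col A)}.
      vec_norm_inf (A *\<^sub>v x) / vec_norm_inf x)"

text \<open>Junk value if \<open>A\<close> is singular.\<close>

definition mat_inv :: "'a :: field mat \<Rightarrow> 'a mat" where
  "mat_inv A = the (mat_inverse A)"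

lemma mat_inv:
  assumes A: "A \<in> carrier_mat n n" and inv: "invertible_mat A"
  shows "mat_inv A \<in> carrier_mat n n" "A * mat_inv A = 1\<^sub>m n" "mat_inv A * A = 1\<^sub>m n"
proof -
  obtain B where B: "A * B = 1\<^sub>m n" "B * A = 1\<^sub>m (dim_row B)"
    using inv A unfolding invertible_mat_def inverts_mat_def by auto
  have "dim_col (A * B) = n" unfolding B(1) by simp
  moreover have "dim_col (B * A) = dim_row B" unfolding B(2) by simp
  ultimately have "B \<in> carrier_mat n n" using A by auto
  then have "A \<in> Units (ring_mat TYPE('a) n ())"
    using A B unfolding Units_def ring_mat_def by auto
  then obtain C where "mat_inverse A = Some C"
    using mat_inverse(1)[OF A, where b = "()"] by (cases "mat_inverse A") auto
  then show "mat_inv A \<in> carrier_mat n n" "A * mat_inv A = 1\<^sub>m n" "mat_inv A * A = 1\<^sub>m n"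
    using mat_inverse(2)[OF A] by (auto simp: mat_inv_def)
qed

definition cond_inf :: "real mat \<Rightarrow> real" where
  "cond_inf X = mat_norm_inf X * mat_norm_inf (mat_inv X)"

definition abs_mat :: "'a :: real_normed_vector mat \<Rightarrow> real mat" where
  "abs_mat A = map_mat norm A"

definition comparison_mat :: "'a :: real_normed_vector mat \<Rightarrow> real mat" where
  "comparison_mat A = mat (dim_row A) (dim_col A)
    (\<lambda>(i, j). if i = j then norm (A $$ (i, j)) else - norm (A $$ (i, j)))"

definition sign_mat :: "nat \<Rightarrow> real mat" where
  "sign_mat n = mat_diag n (\<lambda>i. (- 1) ^ i)"

definition checkerboard :: "real mat \<Rightarrow> bool" where
  "checkerboard A \<longleftrightarrow> (let S = sign_mat (dim_row A) in
    A = S * abs_mat A * S \<or> A = - (S * abs_mat A * S))"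

definition nonneg_mat :: "real mat \<Rightarrow> bool" where
  "nonneg_mat A \<longleftrightarrow> (\<forall>i < dim_row A. \<forall>j < dim_col A. 0 \<le> A $$ (i, j))"

definition upper_bidiagonal :: "'a :: zero mat \<Rightarrow> bool" where
  "upper_bidiagonal A \<longleftrightarrow>
    (\<forall>i < dim_row A. \<forall>j < dim_col A. A $$ (i, j) \<noteq> 0 \<longrightarrow> j = i \<or> j = i + 1)"

definition lower_bidiagonal :: "'a :: zero mat \<Rightarrow> bool" where
  "lower_bidiagonal A \<longleftrightarrow> upper_bidiagonal (transpose_mat A)"

definition mat_prod :: "nat \<Rightarrow> 'a :: semiring_1 mat list \<Rightarrow> 'a mat" where
  "mat_prod n As = foldr (*) As (1\<^sub>m n)"

definition ones_vec :: "nat \<Rightarrow> real vec" where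
  "ones_vec n = vec n (\<lambda>_. 1)"

lemma vec_norm_inf_ge: "i < dim_vec x \<Longrightarrow> \<bar>x $ i\<bar> \<le> vec_norm_inf x"
  unfolding vec_norm_inf_def by (rule Max_ge) auto

lemma vec_norm_inf_le:
  assumes "0 < dim_vec x" "\<And>i. i < dim_vec x \<Longrightarrow> \<bar>x $ i\<bar> \<le> c"
  shows "vec_norm_inf x \<le> c"
  unfolding vec_norm_inf_def using assms by (subst Max_le_iff) auto

lemma vec_norm_inf_pos:
  assumes "x \<in> carrier_vec n" "x \<noteq> 0\<^sub>v n"
  shows "0 < vec_norm_inf x"
proof -
  obtain i where "i < n" "x $ i \<noteq> 0"
    using assms by (metis carrier_vecD eq_vecI index_zero_vec(1) index_zero_vec(2))
  then show ?thesis using vec_norm_inf_ge[of i x] assms(1) by fastforce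
qed

text \<open>The subordinate norm is the maximum absolute row sum.\<close>

lemma mat_norm_inf_row_sum:
  assumes A: "A \<in> carrier_mat m n" and m: "0 < m" and n: "0 < n"
  shows "mat_norm_inf A = Max ((\<lambda>i. \<Sum>j<n. \<bar>A $$ (i, j)\<bar>) ` {..<m})" (is "_ = ?R")
proof -
  let ?X = "{x \<in> carrier_vec n. x \<noteq> 0\<^sub>v n}"
  let ?f = "\<lambda>x. vec_norm_inf (A *\<^sub>v x) / vec_norm_inf x"
  have dims: "dim_row A = m" "dim_col A = n" using A by auto
  have entry: "(A *\<^sub>v x) $ i = (\<Sum>j<n. A $$ (i, j) * x $ j)"
    if "i < m" "x \<in> carrier_vec n" for i x
    using that dims by (simp add: scalar_prod_def lessThan_atLeast0)
  have ub: "?f x \<le> ?R" if x: "x \<in> ?X" for x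
  proof -
    have pos: "0 < vec_norm_inf x" using x vec_norm_inf_pos by blast
    have "vec_norm_inf (A *\<^sub>v x) \<le> ?R * vec_norm_inf x"
    proof (rule vec_norm_inf_le)
      show "0 < dim_vec (A *\<^sub>v x)" using dims m by simp
      fix i assume "i < dim_vec (A *\<^sub>v x)"
      then have i: "i < m" using dims by simp
      have "\<bar>(A *\<^sub>v x) $ i\<bar> \<le> (\<Sum>j<n. \<bar>A $$ (i, j) * x $ j\<bar>)"
        using entry[OF i] x by (simp add: sum_abs)
      also have "\<dots> \<le> (\<Sum>j<n. \<bar>A $$ (i, j)\<bar> * vec_norm_inf x)"
        using x by (intro sum_mono) (auto simp: abs_mult intro!: mult_left_mono vec_norm_inf_ge)
      also have "\<dots> = (\<Sum>j<n. \<bar>A $$ (i, j)\<bar>) * vec_norm_inf x"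
        by (simp add: sum_distrib_right)
      also have "\<dots> \<le> ?R * vec_norm_inf x"
        using i pos by (intro mult_right_mono Max_ge) auto
      finally show "\<bar>(A *\<^sub>v x) $ i\<bar> \<le> ?R * vec_norm_inf x" .
    qed
    then show ?thesis using pos by (simp add: divide_le_eq)
  qed
  obtain i where i: "i < m" and R: "?R = (\<Sum>j<n. \<bar>A $$ (i, j)\<bar>)"
    using Max_in[of "(\<lambda>i. \<Sum>j<n. \<bar>A $$ (i, j)\<bar>) ` {..<m}"] m by fastforce
  define x where "x = vec n (\<lambda>j. if A $$ (i, j) < 0 then - 1 else 1 :: real)"
  have xc: "x \<in> carrier_vec n" by (simp add: x_def)
  have "x $ 0 \<noteq> 0" using n by (simp add: x_def)
  then have "x \<noteq> 0\<^sub>v n" using n by auto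
  then have xX: "x \<in> ?X" using xc by simp
  have pos: "0 < vec_norm_inf x" using xX vec_norm_inf_pos by blast
  have le1: "vec_norm_inf x \<le> 1"
    by (rule vec_norm_inf_le) (use n in \<open>auto simp: x_def\<close>)
  have "?R = (A *\<^sub>v x) $ i"
    unfolding R entry[OF i xc] by (rule sum.cong) (auto simp: x_def)
  also have "\<dots> \<le> vec_norm_inf (A *\<^sub>v x)"
    using vec_norm_inf_ge[of i "A *\<^sub>v x"] i dims by simp
  finally have le: "?R \<le> vec_norm_inf (A *\<^sub>v x)" .
  have "0 \<le> ?R" unfolding R by (simp add: sum_nonneg)
  then have "?R * vec_norm_inf x \<le> ?R * 1" using le1 by (intro mult_left_mono)
  then have "?R \<le> ?f x" using le pos by (simp add: le_divide_eq)
  then have "?f x = ?R" using ub[OF xX] by simp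
  then have "?R \<in> ?f ` ?X" using xX by force
  then have "Sup (?f ` ?X) = ?R"
    by (rule cSup_eq_maximum) (use ub in auto)
  then show ?thesis by (simp add: mat_norm_inf_def dims)
qed


section \<open>Straight-line programs over the entries of the factors\<close>

text \<open>
  The only inputs of a program are the entries of the factors: \<open>Entry l i j\<close> is entry
  \<open>(i, j)\<close> of factor number \<open>l\<close> (counted from 0), and \<open>Reg r\<close> is the result of the
  \<open>r\<close>-th instruction. The instructions cannot depend on the values of the inputs; in
  particular, \<open>IMax\<close> is one comparison followed by a selection.
\<close>

datatype operand = Entry nat nat nat | Const real | Reg nat

datatype instr =
    IAdd operand operand
  | ISub operand operand
  | IMul operand operand
  | IDiv operand operand
  | INeg operand
  | IAbs operand
  | IMax operand operand

fun is_flop :: "instr \<Rightarrow> bool" where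
  "is_flop (IAdd _ _) = True"
| "is_flop (ISub _ _) = True"
| "is_flop (IMul _ _) = True"
| "is_flop (IDiv _ _) = True"
| "is_flop (INeg _) = False"
| "is_flop (IAbs _) = False"
| "is_flop (IMax _ _) = False"

definition flops :: "instr list \<Rightarrow> nat" where
  "flops P = length (filter is_flop P)"

text \<open>
  Execution fails (\<open>None\<close>) on a division by zero, on an entry outside the factors and on
  a register that has not been computed yet.
\<close>

fun operand_val :: "real mat list \<Rightarrow> real list \<Rightarrow> operand \<Rightarrow> real option" where
  "operand_val Bs m (Entry l i j) =
    (if l < length Bs \<and> i < dim_row (Bs ! l) \<and> j < dim_col (Bs ! l)
     then Some (Bs ! l $$ (i, j)) else None)"
| "operand_val Bs m (Const c) = Some c"
| "operand_val Bs m (Reg r) = (if r < length m then Some (m ! r) else None)"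

definition lift2 ::
  "(real \<Rightarrow> real \<Rightarrow> real) \<Rightarrow> real option \<Rightarrow> real option \<Rightarrow> real option" where
  "lift2 f a b = Option.bind a (\<lambda>x. Option.bind b (\<lambda>y. Some (f x y)))"

fun instr_val :: "real mat list \<Rightarrow> real list \<Rightarrow> instr \<Rightarrow> real option" where
  "instr_val Bs m (IAdd a b) = lift2 (+) (operand_val Bs m a) (operand_val Bs m b)"
| "instr_val Bs m (ISub a b) = lift2 (-) (operand_val Bs m a) (operand_val Bs m b)"
| "instr_val Bs m (IMul a b) = lift2 (*) (operand_val Bs m a) (operand_val Bs m b)"
| "instr_val Bs m (IDiv a b) =
    (if operand_val Bs m b = Some 0 then None
     else lift2 (/) (operand_val Bs m a) (operand_val Bs m b))"
| "instr_val Bs m (INeg a) = map_option uminus (operand_val Bs m a)"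
| "instr_val Bs m (IAbs a) = map_option abs (operand_val Bs m a)"
| "instr_val Bs m (IMax a b) = lift2 max (operand_val Bs m a) (operand_val Bs m b)"

primrec exec :: "real mat list \<Rightarrow> instr list \<Rightarrow> real list \<Rightarrow> real list option" where
  "exec Bs [] m = Some m"
| "exec Bs (i # P) m = Option.bind (instr_val Bs m i) (\<lambda>v. exec Bs P (m @ [v]))"


section \<open>The algorithm\<close>

text \<open>
  A program is generated in a state monad whose state is the list of the instructions
  emitted so far. A vector is represented by the list of the operands that hold its
  entries.
\<close>

type_synonym 'a gen = "(instr list, 'a) state"

definition emit :: "instr \<Rightarrow> operand gen" where
  "emit ins = State (\<lambda>P. (Reg (length P), P @ [ins]))"

datatype shape = Upper | Lower

fun has_shape :: "real mat \<Rightarrow> shape \<Rightarrow> bool" where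
  "has_shape A Upper = upper_bidiagonal A"
| "has_shape A Lower = lower_bidiagonal A"

text \<open>Column of the off-diagonal position in row \<open>i\<close>, if there is one.\<close>

fun off_diag :: "nat \<Rightarrow> shape \<Rightarrow> nat \<Rightarrow> nat option" where
  "off_diag n Upper i = (if i + 1 < n then Some (i + 1) else None)"
| "off_diag n Lower i = (if 0 < i then Some (i - 1) else None)"

text \<open>The product \<open>|B|x\<close> for factor number \<open>l\<close>.\<close>

definition matvec_row :: "nat \<Rightarrow> nat \<Rightarrow> shape \<Rightarrow> operand list \<Rightarrow> nat \<Rightarrow> operand gen" where
  "matvec_row n l s x i = do {
     d \<leftarrow> emit (IAbs (Entry l i i));
     t \<leftarrow> emit (IMul d (x ! i));
     (case off_diag n s i of
        None \<Rightarrow> State_Monad.return t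
      | Some j \<Rightarrow> do {
          b \<leftarrow> emit (IAbs (Entry l i j));
          u \<leftarrow> emit (IMul b (x ! j));
          emit (IAdd t u)
        })
   }"

definition bidiag_matvec :: "nat \<Rightarrow> nat \<Rightarrow> shape \<Rightarrow> operand list \<Rightarrow> operand list gen" where
  "bidiag_matvec n l s x = State_Monad.traverse_list (matvec_row n l s x) [0..<n]"

text \<open>
  Solution of \<open>M(B)x = y\<close> for factor number \<open>l\<close> by substitution, the rows being taken in
  the given order. The argument \<open>prev\<close> is the row treated before, with the entry of \<open>x\<close>
  found there. Since the off-diagonal entry of \<open>M(B)\<close> is \<open>-|b|\<close>, the term moved to the
  right-hand side is added.
\<close>

fun subst_rows ::
  "nat \<Rightarrow> operand list \<Rightarrow> (nat \<times> operand) option \<Rightarrow> nat list \<Rightarrow> operand list gen" where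
  "subst_rows l y prev [] = State_Monad.return []"
| "subst_rows l y prev (i # is) = do {
     r \<leftarrow> (case prev of
            None \<Rightarrow> State_Monad.return (y ! i)
          | Some (j, z) \<Rightarrow> do {
              b \<leftarrow> emit (IAbs (Entry l i j));
              t \<leftarrow> emit (IMul b z);
              emit (IAdd (y ! i) t)
            });
     d \<leftarrow> emit (IAbs (Entry l i i));
     x \<leftarrow> emit (IDiv r d);
     xs \<leftarrow> subst_rows l y (Some (i, x)) is;
     State_Monad.return (x # xs)
   }"

fun bidiag_subst :: "nat \<Rightarrow> nat \<Rightarrow> shape \<Rightarrow> operand list \<Rightarrow> operand list gen" where
  "bidiag_subst n l Lower y = subst_rows l y None [0..<n]"
| "bidiag_subst n l Upper y = do {
     xs \<leftarrow> subst_rows l y None (rev [0..<n]);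
     State_Monad.return (rev xs)
   }"

text \<open>\<open>|B\<^sub>1|(|B\<^sub>2|(\<dots>(|B\<^sub>k|x)))\<close>\<close>

fun matvec_chain :: "nat \<Rightarrow> (nat \<times> shape) list \<Rightarrow> operand list \<Rightarrow> operand list gen" where
  "matvec_chain n [] x = State_Monad.return x"
| "matvec_chain n ((l, s) # fs) x = do {
     y \<leftarrow> matvec_chain n fs x;
     bidiag_matvec n l s y
   }"

text \<open>\<open>M(B\<^sub>k)\<^sup>-\<^sup>1(\<dots>(M(B\<^sub>2)\<^sup>-\<^sup>1(M(B\<^sub>1)\<^sup>-\<^sup>1 x)))\<close>\<close>

fun subst_chain :: "nat \<Rightarrow> (nat \<times> shape) list \<Rightarrow> operand list \<Rightarrow> operand list gen" where
  "subst_chain n [] x = State_Monad.return x"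
| "subst_chain n ((l, s) # fs) x = do {
     y \<leftarrow> bidiag_subst n l s x;
     subst_chain n fs y
   }"

fun norm_gen :: "operand list \<Rightarrow> operand gen" where
  "norm_gen [] = State_Monad.return (Const 0)"
| "norm_gen (x # xs) = do {
     a \<leftarrow> emit (IAbs x);
     b \<leftarrow> norm_gen xs;
     emit (IMax a b)
   }"

text \<open>
  The results are the operands that hold the two norms and their product. The generated
  program depends only on \<open>n\<close> and on the shapes of the factors.
\<close>

definition cond_gen :: "nat \<Rightarrow> shape list \<Rightarrow> (operand \<times> operand \<times> operand) gen" where
  "cond_gen n sh = do {
     let e = replicate n (Const 1);
     x \<leftarrow> matvec_chain n (List.enumerate 0 sh) e;
     p \<leftarrow> norm_gen x;
     y \<leftarrow> subst_chain n (List.enumerate 0 sh) e;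
     q \<leftarrow> norm_gen y;
     r \<leftarrow> emit (IMul p q);
     State_Monad.return (p, q, r)
   }"

end

theory Submission
  imports Defs "Jordan_Normal_Form.Determinant"
begin

text \<open>
  A norm \<open>\<parallel>C\<parallel>\<close> is the largest entry of \<open>|C|e\<close>, so no cancellation may happen in the two products
  of the statement. Both hypotheses exclude it through one sign symmetry: there is \<open>t \<in> {1, -1}\<close>
  such that every factor is \<open>B = c D |B| D\<close> with \<open>D = diag(1, t, t\<^sup>2, \<dots>)\<close> and \<open>c \<in> {1, -1}\<close>;
  nonnegativity is \<open>t = 1\<close> and a checkerboard pattern is \<open>t = -1\<close>. Since \<open>D\<^sup>2 = 1\<close>, products and
  inverses keep this form (\<open>mat_prod_scale\<close>, \<open>mat_inv_scale\<close>). Hence \<open>|B\<^sub>1\<dots>B\<^sub>k| = |B\<^sub>1|\<dots>|B\<^sub>k|\<close>,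
  which is the first identity.

  For the inverses, the off-diagonal entries of a bidiagonal matrix are in positions with \<open>i + j\<close>
  odd, so that \<open>M(B)\<close> is \<open>|B|\<close> with the signs \<open>(-1)\<^sup>i\<^sup>+\<^sup>j\<close> (\<open>comparison_mat_eq_scale\<close>). Thus \<open>B\<close> arises
  from \<open>M(B)\<close> by the same kind of scaling, with \<open>-t\<close> in the place of \<open>t\<close>, and so does the inverse
  of \<open>B\<close> from that of \<open>M(B)\<close>. The latter is nonnegative, because substitution in a system with
  matrix \<open>M(B)\<close> only adds, multiplies and divides nonnegative numbers
  (\<open>comparison_solution_nonneg\<close>). The second identity follows as the first one does.

  The algorithm is verified by rules for sequential composition (\<open>computes_bind\<close>) that carry along
  the values held by the registers and a bound for the number of flops. A product with \<open>|B|\<close> costs at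
  most \<open>3n\<close> flops. A substitution costs \<open>3n - 2\<close>, as its first row needs the division only. The
  \<open>2k\<close> flops saved in this way pay for the final multiplication of the two norms.
\<close>

section \<open>Sign scalings\<close>

text \<open>The matrix \<open>s D C D\<close> for \<open>D = diag(1, t, t\<^sup>2, \<dots>)\<close>.\<close>

definition scale :: "real \<Rightarrow> real \<Rightarrow> real mat \<Rightarrow> real mat" where
  "scale s t C = mat (dim_row C) (dim_col C) (\<lambda>(i, j). s * t ^ (i + j) * C $$ (i, j))"

lemma scale_carrier [simp]: "scale s t C \<in> carrier_mat n m \<longleftrightarrow> C \<in> carrier_mat n m"
  unfolding carrier_mat_def by (simp add: scale_def)

lemma scale_index [simp]:
  "C \<in> carrier_mat n m \<Longrightarrow> i < n \<Longrightarrow> j < m \<Longrightarrow>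
    scale s t C $$ (i, j) = s * t ^ (i + j) * C $$ (i, j)"
  by (auto simp: scale_def)

lemma sign_square: "\<bar>t\<bar> = 1 \<Longrightarrow> t * t = (1 :: real)"
  by (metis abs_mult_self_eq mult_1)

lemma sign_power_double: "\<bar>t\<bar> = 1 \<Longrightarrow> t ^ (k + k) = (1 :: real)"
  by (metis mult_2 one_power2 power2_abs power_mult power_one)

lemma scale_scale: "scale s t (scale s' t' C) = scale (s * s') (t * t') C"
  by (rule eq_matI) (auto simp: scale_def power_mult_distrib)

lemma scale_one_mat: "\<bar>t\<bar> = 1 \<Longrightarrow> scale 1 t (1\<^sub>m n) = 1\<^sub>m n"
  by (rule eq_matI) (auto simp: scale_def sign_power_double)

lemma scale_1_1 [simp]: "scale 1 1 C = C"
  by (rule eq_matI) (auto simp: scale_def)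

text \<open>
  The inner index of a product enters through \<open>t ^ (i + k) * t ^ (k + j)\<close>, where the two
  factors \<open>t ^ k\<close> cancel.
\<close>

lemma scale_mult:
  assumes "\<bar>t\<bar> = 1" "C \<in> carrier_mat n m" "D \<in> carrier_mat m l"
  shows "scale s t C * scale s' t D = scale (s * s') t (C * D)"
proof (rule eq_matI)
  fix i j assume "i < dim_row (scale (s * s') t (C * D))" "j < dim_col (scale (s * s') t (C * D))"
  then have ij: "i < n" "j < l" using assms by (auto simp: scale_def)
  have t: "t ^ (i + k) * t ^ (k + j) = t ^ (i + j)" for k
    using sign_power_double[OF assms(1), of k] by (simp add: power_add)
  have *: "(s * t ^ (i + k) * c) * (s' * t ^ (k + j) * d) = (s * s' * t ^ (i + j)) * (c * d)"
    for k c d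
  proof -
    have "(s * t ^ (i + k) * c) * (s' * t ^ (k + j) * d) =
        (s * s' * (t ^ (i + k) * t ^ (k + j))) * (c * d)"
      by (simp only: ac_simps)
    then show ?thesis using t by simp
  qed
  show "(scale s t C * scale s' t D) $$ (i, j) = scale (s * s') t (C * D) $$ (i, j)"
    using ij assms by (auto simp: scalar_prod_def scale_def * sum_distrib_left intro!: sum.cong)
qed (use assms in \<open>auto simp: scale_def\<close>)

lemma mat_inv_unique:
  assumes "A \<in> carrier_mat n n" "X \<in> carrier_mat n n" "A * X = 1\<^sub>m n"
  shows "mat_inv A = X"
proof -
  have XA: "X * A = 1\<^sub>m n" using assms by (rule mat_mult_left_right_inverse)
  then have "invertible_mat A"
    using assms by (auto simp: invertible_mat_def inverts_mat_def)
  note inv = mat_inv[OF assms(1) this]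
  have "mat_inv A = (X * A) * mat_inv A" using inv XA by simp
  also have "\<dots> = X" using assms inv by simp
  finally show ?thesis .
qed

lemma mat_inv_scale:
  assumes "\<bar>s\<bar> = 1" "\<bar>t\<bar> = 1" "C \<in> carrier_mat n n" "invertible_mat C"
  shows "mat_inv (scale s t C) = scale s t (mat_inv C)"
proof (rule mat_inv_unique)
  note inv = mat_inv[OF assms(3,4)]
  show "scale s t C * scale s t (mat_inv C) = 1\<^sub>m n"
    using assms inv by (simp add: scale_mult[of t _ n n _ n] sign_square scale_one_mat)
qed (use assms mat_inv in auto)

lemma mat_prod_carrier:
  "(\<And>A. A \<in> set As \<Longrightarrow> A \<in> carrier_mat n n) \<Longrightarrow> mat_prod n As \<in> carrier_mat n n"
proof (induction As)
  case (Cons A As)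
  then show ?case by (auto simp: mat_prod_def intro!: mult_carrier_mat[of _ n n])
qed (simp add: mat_prod_def)

lemma mat_prod_Nil [simp]: "mat_prod n [] = 1\<^sub>m n"
  by (simp add: mat_prod_def)

lemma mat_prod_Cons [simp]: "mat_prod n (A # As) = A * mat_prod n As"
  by (simp add: mat_prod_def)

lemma mat_prod_snoc:
  assumes "\<And>B. B \<in> set As \<Longrightarrow> B \<in> carrier_mat n n" "A \<in> carrier_mat n n"
  shows "mat_prod n (As @ [A]) = mat_prod n As * A"
  using assms
proof (induction As)
  case (Cons B As)
  have "mat_prod n ((B # As) @ [A]) = B * (mat_prod n As * A)" using Cons by simp
  also have "\<dots> = B * mat_prod n As * A"
    by (rule assoc_mult_mat[symmetric, of B n n _ n _ n])
      (use Cons.prems in \<open>auto intro: mat_prod_carrier\<close>)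
  finally show ?case by simp
qed simp

lemma mat_inv_mat_prod:
  assumes "\<And>A. A \<in> set As \<Longrightarrow> A \<in> carrier_mat n n \<and> invertible_mat A"
  shows "mat_inv (mat_prod n As) = mat_prod n (map mat_inv (rev As))"
proof -
  have "mat_prod n As \<in> carrier_mat n n"
    using assms by (intro mat_prod_carrier) simp
  moreover have "mat_prod n (map mat_inv (rev As)) \<in> carrier_mat n n"
    using assms by (intro mat_prod_carrier) (auto intro: mat_inv(1))
  moreover have "mat_prod n As * mat_prod n (map mat_inv (rev As)) = 1\<^sub>m n"
    using assms
  proof (induction As)
    case (Cons A As)
    let ?P = "mat_prod n As" and ?Q = "mat_prod n (map mat_inv (rev As))"
    have A: "A \<in> carrier_mat n n" and inv: "invertible_mat A" using Cons.prems by auto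
    note iA = mat_inv[OF A inv]
    have car: "B \<in> carrier_mat n n" if "B \<in> set (map mat_inv (rev As))" for B
      using that Cons.prems by (auto intro: mat_inv(1))
    have P: "?P \<in> carrier_mat n n" using Cons.prems by (intro mat_prod_carrier) auto
    have Q: "?Q \<in> carrier_mat n n" using car by (rule mat_prod_carrier)
    have "mat_prod n (map mat_inv (rev As) @ [mat_inv A]) = ?Q * mat_inv A"
      using car iA(1) by (rule mat_prod_snoc)
    then have "mat_prod n (A # As) * mat_prod n (map mat_inv (rev (A # As)))
        = (A * ?P) * (?Q * mat_inv A)"
      by simp
    also have "\<dots> = A * ((?P * ?Q) * mat_inv A)"
      unfolding assoc_mult_mat[OF A P mult_carrier_mat[OF Q iA(1)]] assoc_mult_mat[OF P Q iA(1)] ..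
    also have "\<dots> = 1\<^sub>m n"
    proof -
      have "?P * ?Q = 1\<^sub>m n" using Cons.prems by (intro Cons.IH) auto
      then show ?thesis using iA by simp
    qed
    finally show ?case .
  qed simp
  ultimately show ?thesis by (rule mat_inv_unique)
qed

text \<open>
  The sign \<open>s\<close> may differ between the factors, but \<open>t\<close> must be the same for all of them: the
  products of signs over the inner indices cancel only then.
\<close>

lemma mat_prod_scale:
  assumes "\<bar>t\<bar> = 1"
    and "\<And>B. B \<in> set Bs \<Longrightarrow> f B \<in> carrier_mat n n \<and> (\<exists>s. \<bar>s\<bar> = 1 \<and> g B = scale s t (f B))"
  shows "\<exists>s. \<bar>s\<bar> = 1 \<and> mat_prod n (map g Bs) = scale s t (mat_prod n (map f Bs))"
  using assms(2)
proof (induction Bs)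
  case Nil
  then show ?case using scale_one_mat[OF assms(1)] by (intro exI[of _ 1]) simp
next
  case (Cons B Bs)
  obtain s where s: "\<bar>s\<bar> = 1" "g B = scale s t (f B)" and B: "f B \<in> carrier_mat n n"
    using Cons.prems by auto
  obtain s' where s': "\<bar>s'\<bar> = 1" "mat_prod n (map g Bs) = scale s' t (mat_prod n (map f Bs))"
    using Cons by auto
  have "mat_prod n (map f Bs) \<in> carrier_mat n n"
    using Cons.prems by (intro mat_prod_carrier) auto
  then have "mat_prod n (map g (B # Bs)) = scale (s * s') t (mat_prod n (map f (B # Bs)))"
    using s s' B scale_mult[OF assms(1)] by simp
  then show ?case using s s' by (intro exI[of _ "s * s'"]) (simp add: abs_mult)
qed

lemma nonneg_mat_prod:
  assumes "\<And>A. A \<in> set As \<Longrightarrow> A \<in> carrier_mat n n \<and> nonneg_mat A"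
  shows "nonneg_mat (mat_prod n As)"
  using assms
proof (induction As)
  case (Cons A As)
  then have "A \<in> carrier_mat n n" "mat_prod n As \<in> carrier_mat n n"
    by (auto intro: mat_prod_carrier)
  moreover have "nonneg_mat A" "nonneg_mat (mat_prod n As)" using Cons by auto
  ultimately show ?case
    by (auto simp: nonneg_mat_def scalar_prod_def intro!: sum_nonneg)
qed (auto simp: nonneg_mat_def)

text \<open>
  A sign scaling does not change absolute row sums, and those of a nonnegative matrix are the entries
  of its product with the vector of ones.
\<close>

lemma mat_norm_inf_scale:
  assumes "\<bar>s\<bar> = 1" "\<bar>t\<bar> = 1" and C: "C \<in> carrier_mat n n" "nonneg_mat C" and n: "0 < n"
  shows "mat_norm_inf (scale s t C) = vec_norm_inf (C *\<^sub>v ones_vec n)"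
proof -
  have "(\<Sum>j<n. \<bar>scale s t C $$ (i, j)\<bar>) = \<bar>(C *\<^sub>v ones_vec n) $ i\<bar>" if i: "i < n" for i
  proof -
    have "0 \<le> (\<Sum>j<n. C $$ (i, j))" using C i by (auto simp: nonneg_mat_def intro: sum_nonneg)
    moreover have "(\<Sum>j<n. \<bar>scale s t C $$ (i, j)\<bar>) = (\<Sum>j<n. C $$ (i, j))"
      using assms i by (intro sum.cong) (auto simp: abs_mult power_abs nonneg_mat_def)
    moreover have "(\<Sum>j<n. C $$ (i, j)) = (C *\<^sub>v ones_vec n) $ i"
      using C i by (simp add: ones_vec_def scalar_prod_def lessThan_atLeast0)
    ultimately show ?thesis by simp
  qed
  then have "(\<lambda>i. \<Sum>j<n. \<bar>scale s t C $$ (i, j)\<bar>) ` {..<n} =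
      (\<lambda>i. \<bar>(C *\<^sub>v ones_vec n) $ i\<bar>) ` {..<n}"
    by (intro image_cong) auto
  then show ?thesis
    using mat_norm_inf_row_sum[of "scale s t C" n n] C n
    by (simp add: vec_norm_inf_def)
qed


section \<open>Bidiagonal matrices\<close>

text \<open>
  This form of the shape lets the upper and the lower case share the proofs below: row \<open>i\<close> has at
  most one off-diagonal entry, and substitution has found the corresponding unknown before.
\<close>

lemma has_shape_iff:
  assumes "A \<in> carrier_mat n n"
  shows "has_shape A s \<longleftrightarrow>
    (\<forall>i<n. \<forall>j<n. A $$ (i, j) \<noteq> 0 \<longrightarrow> j = i \<or> off_diag n s i = Some j)"
proof (cases s)
  case Upper
  have "off_diag n Upper i = Some j \<longleftrightarrow> j = Suc i" if "j < n" for i j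
    using that by auto
  then show ?thesis
    using assms Upper by (auto simp: upper_bidiagonal_def simp del: off_diag.simps)
next
  case Lower
  have "off_diag n Lower i = Some j \<longleftrightarrow> i = Suc j" for i j
    by auto
  then show ?thesis
    using assms Lower
    by (auto simp: upper_bidiagonal_def lower_bidiagonal_def simp del: off_diag.simps)
qed

lemma ex_has_shape: "list_all2 has_shape Bs sh \<Longrightarrow> B \<in> set Bs \<Longrightarrow> \<exists>s. has_shape B s"
  by (induction rule: list_all2_induct) auto

lemma has_shape_abs_mat:
  fixes A :: "real mat"
  assumes "A \<in> carrier_mat n n" "has_shape A s"
  shows "has_shape (abs_mat A) s"
  using assms has_shape_iff[of A n s] has_shape_iff[of "abs_mat A" n s]
  by (auto simp: abs_mat_def)

lemma has_shape_comparison_mat: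
  fixes A :: "real mat"
  assumes "A \<in> carrier_mat n n" "has_shape A s"
  shows "has_shape (comparison_mat A) s"
  using assms has_shape_iff[of A n s] has_shape_iff[of "comparison_mat A" n s]
  by (auto simp: comparison_mat_def)

lemma off_diagD: "off_diag n s i = Some j \<Longrightarrow> i < n \<Longrightarrow> j < n \<and> j \<noteq> i \<and> (j = Suc i \<or> i = Suc j)"
  by (cases s) (auto split: if_splits)

lemma bidiagonal_mult_vec:
  assumes A: "A \<in> carrier_mat n n" "has_shape A s" and x: "x \<in> carrier_vec n" and i: "i < n"
  shows "(A *\<^sub>v x) $ i = A $$ (i, i) * x $ i +
    (case off_diag n s i of None \<Rightarrow> 0 | Some j \<Rightarrow> A $$ (i, j) * x $ j)"
proof -
  let ?J = "insert i (set_option (off_diag n s i))"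
  have "(A *\<^sub>v x) $ i = (\<Sum>j<n. A $$ (i, j) * x $ j)"
    using A x i by (simp add: scalar_prod_def lessThan_atLeast0)
  also have "\<dots> = (\<Sum>j\<in>?J. A $$ (i, j) * x $ j)"
  proof (rule sum.mono_neutral_right)
    show "?J \<subseteq> {..<n}" using i off_diagD[of n s i] by auto
    show "\<forall>j\<in>{..<n} - ?J. A $$ (i, j) * x $ j = 0"
      using A(2) i unfolding has_shape_iff[OF A(1)] by (auto simp: elem_set)
  qed simp
  also have "\<dots> = A $$ (i, i) * x $ i +
    (case off_diag n s i of None \<Rightarrow> 0 | Some j \<Rightarrow> A $$ (i, j) * x $ j)"
    using off_diagD[of n s i] i by (auto split: option.split)
  finally show ?thesis .
qed

text \<open>
  Both shapes are triangular. The criterion sees the diagonal only up to absolute value, which carries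
  invertibility over from \<open>B\<close> to \<open>M(B)\<close>.
\<close>

lemma bidiagonal_invertible_iff:
  fixes A :: "real mat"
  assumes A: "A \<in> carrier_mat n n" "has_shape A s"
  shows "invertible_mat A \<longleftrightarrow> (\<forall>i<n. A $$ (i, i) \<noteq> 0)"
proof -
  have zero: "A $$ (i, j) = 0" if "i < n" "j < n" "j \<noteq> i" "off_diag n s i \<noteq> Some j" for i j
    using A that has_shape_iff by blast
  have "det A = prod_list (diag_mat A)"
  proof (cases s)
    case Upper
    then have "upper_triangular A"
      using A(1) by (intro upper_triangularI zero) auto
    then show ?thesis using A(1) by (rule det_upper_triangular)
  next
    case Lower
    then have "A $$ (i, j) = 0" if "i < j" "j < n" for i j
      using that by (intro zero) auto
    then show ?thesis using A(1) by (rule det_lower_triangular)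
  qed
  then have "det A \<noteq> 0 \<longleftrightarrow> (\<forall>i<n. A $$ (i, i) \<noteq> 0)"
    using A by (auto simp: diag_mat_def prod_list_zero_iff)
  moreover have "invertible_mat A \<longleftrightarrow> det A \<noteq> 0"
  proof
    assume "invertible_mat A"
    note inv = mat_inv[OF A(1) this]
    show "det A \<noteq> 0" using det_mult[OF A(1) inv(1)] inv(2) by auto
  next
    assume "det A \<noteq> 0"
    then have "A \<in> Units (ring_mat TYPE(real) n ())" using A by (intro det_non_zero_imp_unit)
    then show "invertible_mat A" using A
      by (auto simp: Units_def ring_mat_def invertible_mat_def inverts_mat_def)
  qed
  ultimately show ?thesis by simp
qed

locale bidiagonal =
  fixes n :: nat and B :: "real mat" and s :: shape
  assumes carrier: "B \<in> carrier_mat n n" and shape: "has_shape B s" and inv: "invertible_mat B"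
begin

lemma diag: "i < n \<Longrightarrow> B $$ (i, i) \<noteq> 0"
  using bidiagonal_invertible_iff carrier shape inv by blast

lemma comparison_carrier: "comparison_mat B \<in> carrier_mat n n"
  using carrier by (simp add: comparison_mat_def)

lemma comparison_invertible: "invertible_mat (comparison_mat B)"
  using bidiagonal_invertible_iff[OF comparison_carrier has_shape_comparison_mat] carrier shape diag
  by (auto simp: comparison_mat_def)

lemmas comparison_inv = mat_inv[OF comparison_carrier comparison_invertible]

text \<open>
  Row \<open>i\<close> of a linear system with matrix \<open>M(B)\<close>, in the form in which substitution uses it. No
  subtraction is left, which is the source both of nonnegativity and of the sums in the algorithm.
\<close>

lemma comparison_system:
  assumes "x \<in> carrier_vec n" "i < n"
  shows "\<bar>B $$ (i, i)\<bar> * x $ i = (comparison_mat B *\<^sub>v x) $ i +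
    (case off_diag n s i of None \<Rightarrow> 0 | Some j \<Rightarrow> \<bar>B $$ (i, j)\<bar> * x $ j)"
proof -
  have "comparison_mat B $$ (i, i) = \<bar>B $$ (i, i)\<bar>"
    using carrier assms(2) by (simp add: comparison_mat_def)
  moreover have "comparison_mat B $$ (i, j) = - \<bar>B $$ (i, j)\<bar>" if "off_diag n s i = Some j" for j
    using carrier assms(2) off_diagD[OF that] by (simp add: comparison_mat_def)
  ultimately show ?thesis
    using bidiagonal_mult_vec[OF comparison_carrier
        has_shape_comparison_mat[OF carrier shape] assms]
    by (simp split: option.splits)
qed

text \<open>
  Induction in the order of substitution: upwards from row \<open>0\<close> for a lower bidiagonal matrix,
  downwards from row \<open>n - 1\<close> for an upper bidiagonal one.
\<close>

lemma comparison_solution_nonneg: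
  assumes x: "x \<in> carrier_vec n" and y: "\<And>i. i < n \<Longrightarrow> 0 \<le> (comparison_mat B *\<^sub>v x) $ i"
    and i: "i < n"
  shows "0 \<le> x $ i"
proof -
  have step: "0 \<le> x $ i"
    if "i < n" "\<And>j. off_diag n s i = Some j \<Longrightarrow> 0 \<le> x $ j" for i
  proof -
    have "0 \<le> \<bar>B $$ (i, i)\<bar> * x $ i"
      using comparison_system[OF x that(1)] y[OF that(1)] that(2)
      by (auto split: option.splits)
    then show ?thesis using diag[OF that(1)] by (simp add: zero_le_mult_iff)
  qed
  show ?thesis
  proof (cases s)
    case Lower
    show ?thesis using i
    proof (induction i)
      case 0
      then show ?case using step[of 0] Lower by simp
    next
      case (Suc i)
      then show ?case using step[of "Suc i"] Lower by simp
    qed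
  next
    case Upper
    show ?thesis using i
    proof (induction "n - i" arbitrary: i rule: less_induct)
      case less
      have "0 \<le> x $ Suc i" if "Suc i < n"
        using less.prems that by (intro less.hyps) auto
      then show ?case using less.prems Upper by (auto intro!: step[of i] split: if_splits)
    qed
  qed
qed

text \<open>The columns of the inverse solve systems whose right-hand sides are unit vectors.\<close>

lemma comparison_inv_nonneg: "nonneg_mat (mat_inv (comparison_mat B))"
  unfolding nonneg_mat_def
proof (intro allI impI)
  let ?M = "comparison_mat B" and ?X = "mat_inv (comparison_mat B)"
  fix i j assume "i < dim_row ?X" "j < dim_col ?X"
  then have ij: "i < n" "j < n" using comparison_inv(1) by auto
  have "(?M *\<^sub>v col ?X j) $ k = (1\<^sub>m n) $$ (k, j)" if "k < n" for k
    using that ij comparison_inv(1) comparison_carrier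
      arg_cong[OF comparison_inv(2), of "\<lambda>A. A $$ (k, j)"]
    by simp
  then have "0 \<le> (?M *\<^sub>v col ?X j) $ k" if "k < n" for k
    using that ij(2) by simp
  then have "0 \<le> col ?X j $ i"
    by (rule comparison_solution_nonneg[rotated]) (use comparison_inv(1) ij in auto)
  then show "0 \<le> ?X $$ (i, j)" using ij comparison_inv(1) by simp
qed

text \<open>
  This is where bidiagonality matters: a nonzero entry is on the diagonal, where \<open>i + j\<close> is even, or
  next to it, where \<open>i + j\<close> is odd.
\<close>

lemma comparison_mat_eq_scale: "comparison_mat B = scale 1 (- 1) (abs_mat B)"
proof (rule eq_matI)
  fix i j assume "i < dim_row (scale 1 (- 1) (abs_mat B))" "j < dim_col (scale 1 (- 1) (abs_mat B))"
  then have ij: "i < n" "j < n" using carrier by (auto simp: scale_def abs_mat_def)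
  then have "j = i \<or> j = Suc i \<or> i = Suc j" if "B $$ (i, j) \<noteq> 0"
    using that carrier shape has_shape_iff[of B n s] off_diagD[of n s i j] by auto
  then show "comparison_mat B $$ (i, j) = scale 1 (- 1) (abs_mat B) $$ (i, j)"
    using ij carrier
    by (cases "B $$ (i, j) = 0") (auto simp: comparison_mat_def scale_def abs_mat_def
      simp flip: mult_2)
qed (auto simp: comparison_mat_def scale_def abs_mat_def)

lemma mat_inv_eq_scale:
  assumes "\<bar>c\<bar> = 1" "\<bar>t\<bar> = 1" "B = scale c t (abs_mat B)"
  shows "mat_inv B = scale c (- t) (mat_inv (comparison_mat B))"
proof -
  have "B = scale c (- t) (comparison_mat B)"
    using assms(3) by (simp add: comparison_mat_eq_scale scale_scale)
  then show ?thesis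
    using mat_inv_scale[OF assms(1) _ comparison_carrier comparison_invertible, of "- t"] assms(2)
    by simp
qed

end

lemma nonneg_eq_scale: "nonneg_mat B \<Longrightarrow> B = scale 1 1 (abs_mat B)"
  by (rule eq_matI) (auto simp: nonneg_mat_def abs_mat_def)

lemma checkerboard_eq_scale:
  assumes B: "B \<in> carrier_mat n n" and "checkerboard B"
  shows "\<exists>c. \<bar>c\<bar> = 1 \<and> B = scale c (- 1) (abs_mat B)"
proof -
  have A: "abs_mat B \<in> carrier_mat n n" using B by (simp add: abs_mat_def)
  have "sign_mat n * abs_mat B * sign_mat n = scale 1 (- 1) (abs_mat B)"
    unfolding sign_mat_def mat_diag_mult_left[OF A]
    by (subst mat_diag_mult_right[of _ n])
      (use A in \<open>auto simp: scale_def power_add intro!: eq_matI\<close>)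
  moreover have "- scale 1 (- 1) (abs_mat B) = scale (- 1) (- 1) (abs_mat B)"
    by (rule eq_matI) (auto simp: scale_def)
  ultimately have "B = scale 1 (- 1) (abs_mat B) \<or> B = scale (- 1) (- 1) (abs_mat B)"
    using assms by (simp add: checkerboard_def)
  then show ?thesis by (metis abs_minus_cancel abs_one)
qed


section \<open>Values and flops of generated programs\<close>

text \<open>
  A Hoare triple with costs. The list \<open>m\<close> of register contents takes the place of a precondition; the
  instructions already emitted matter only through it. Registers are never overwritten, so the
  contents afterwards extend \<open>m\<close>, and whatever is known of a register remains true.
\<close>

definition computes ::
  "real mat list \<Rightarrow> real list \<Rightarrow> 'a gen \<Rightarrow> nat \<Rightarrow> (real list \<Rightarrow> 'a \<Rightarrow> bool) \<Rightarrow> bool" where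
  "computes Bs m g k Q \<longleftrightarrow> (\<forall>P. exec Bs P [] = Some m \<longrightarrow>
    (\<exists>a P' m'. run_state g P = (a, P') \<and> exec Bs P' [] = Some (m @ m') \<and>
      flops P' \<le> flops P + k \<and> Q (m @ m') a))"

text \<open>
  The operands \<open>xs\<close> hold the values of \<open>f\<close> at the indices \<open>is\<close>. The index list is explicit because
  substitution finds the unknowns of an upper bidiagonal system in reverse order.
\<close>

definition holds :: "real mat list \<Rightarrow> real list \<Rightarrow> (nat \<Rightarrow> real) \<Rightarrow> nat list \<Rightarrow> operand list \<Rightarrow> bool" where
  "holds Bs m f is xs \<longleftrightarrow> list_all2 (\<lambda>i x. operand_val Bs m x = Some (f i)) is xs"

lemma exec_append: "exec Bs (P @ Q) m = Option.bind (exec Bs P m) (exec Bs Q)"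
  by (induction P arbitrary: m) (auto split: bind_splits simp: Option.bind_eq_None_conv)

lemma exec_length: "exec Bs P m = Some m' \<Longrightarrow> length m' = length m + length P"
  by (induction P arbitrary: m) (auto split: bind_splits)

lemma operand_val_append:
  "operand_val Bs m a = Some v \<Longrightarrow> operand_val Bs (m @ m') a = Some v"
  by (cases a) (auto split: if_splits simp: nth_append)

lemma holds_append: "holds Bs m f is xs \<Longrightarrow> holds Bs (m @ m') f is xs"
  unfolding holds_def by (erule list_all2_mono) (rule operand_val_append)

lemma holds_nth: "holds Bs m f [0..<n] xs \<Longrightarrow> i < n \<Longrightarrow> operand_val Bs m (xs ! i) = Some (f i)"
  unfolding holds_def by (drule list_all2_nthD[of _ _ _ i]) auto

lemma computes_return: "Q m a \<Longrightarrow> computes Bs m (State_Monad.return a) k Q"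
  unfolding computes_def by auto

lemma computes_emit:
  assumes "instr_val Bs m ins = Some v"
  shows "computes Bs m (emit ins) (if is_flop ins then 1 else 0)
    (\<lambda>m' a. operand_val Bs m' a = Some v)"
  unfolding computes_def
proof (intro allI impI)
  fix P assume P: "exec Bs P [] = Some m"
  \<comment> \<open>so the register named by \<open>emit\<close> is the one appended to \<open>m\<close>\<close>
  then have "length m = length P" using exec_length by fastforce
  then show "\<exists>a P' m'. run_state (emit ins) P = (a, P') \<and> exec Bs P' [] = Some (m @ m') \<and>
      flops P' \<le> flops P + (if is_flop ins then 1 else 0) \<and> operand_val Bs (m @ m') a = Some v"
    using P assms by (auto simp: emit_def exec_append flops_def nth_append)
qed

lemma computes_bind:
  assumes "computes Bs m g k Q"
    and "\<And>m' a. Q (m @ m') a \<Longrightarrow> computes Bs (m @ m') (h a) k' R"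
    and "k + k' \<le> l"
  shows "computes Bs m (State_Monad.bind g h) l R"
  unfolding computes_def
proof (intro allI impI)
  fix P assume "exec Bs P [] = Some m"
  then obtain a P' m' where 1: "run_state g P = (a, P')" "exec Bs P' [] = Some (m @ m')"
      "flops P' \<le> flops P + k" "Q (m @ m') a"
    using assms(1) unfolding computes_def by blast
  then obtain b P'' m'' where "run_state (h a) P' = (b, P'')"
      "exec Bs P'' [] = Some ((m @ m') @ m'')"
      "flops P'' \<le> flops P' + k'" "R ((m @ m') @ m'') b"
    using assms(2) unfolding computes_def by blast
  then show "\<exists>b P'' m''. run_state (State_Monad.bind g h) P = (b, P'') \<and>
      exec Bs P'' [] = Some (m @ m'') \<and> flops P'' \<le> flops P + l \<and> R (m @ m'') b"
    using 1 assms(3) by auto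
qed

lemma computes_mono:
  assumes "computes Bs m g k Q" "k \<le> k'" "\<And>m' a. Q (m @ m') a \<Longrightarrow> R (m @ m') a"
  shows "computes Bs m g k' R"
  using assms unfolding computes_def by (meson add_left_mono le_trans)

lemma computes_emit_bind:
  assumes "instr_val Bs m ins = Some v"
    and "\<And>m' a. operand_val Bs (m @ m') a = Some v \<Longrightarrow> computes Bs (m @ m') (h a) k R"
    and "k + (if is_flop ins then 1 else 0) \<le> l"
  shows "computes Bs m (State_Monad.bind (emit ins) h) l R"
  by (rule computes_bind[OF computes_emit[OF assms(1)] assms(2)]) (use assms(3) in auto)

lemma computes_emit_last:
  assumes "instr_val Bs m ins = Some v" "(if is_flop ins then 1 else 0) \<le> l"
    and "\<And>m' a. operand_val Bs (m @ m') a = Some v \<Longrightarrow> R (m @ m') a"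
  shows "computes Bs m (emit ins) l R"
  by (rule computes_mono[OF computes_emit[OF assms(1)] assms(2)]) (rule assms(3))

lemma computes_traverse_list:
  assumes "\<And>i m'. i \<in> set is \<Longrightarrow>
    computes Bs (m @ m') (g i) k (\<lambda>m'' a. operand_val Bs m'' a = Some (f i))"
  shows "computes Bs m (State_Monad.traverse_list g is) (k * length is) (\<lambda>m'. holds Bs m' f is)"
  using assms
proof (induction "is" arbitrary: m)
  case Nil
  then show ?case by (auto simp: holds_def intro: computes_return)
next
  case (Cons i "is")
  have hd: "computes Bs m (g i) k (\<lambda>m'' a. operand_val Bs m'' a = Some (f i))"
    using Cons.prems[of i "[]"] by simp
  have tl: "computes Bs (m @ m') (State_Monad.traverse_list g is) (k * length is)
      (\<lambda>m'. holds Bs m' f is)" for m'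
    by (rule Cons.IH) (use Cons.prems in auto)
  show ?case unfolding State_Monad.traverse_list.simps
    by (rule computes_bind[OF hd computes_bind[OF tl computes_return[where k = 0]]])
      (auto simp: holds_def simp del: append_assoc intro: operand_val_append)
qed


section \<open>Bidiagonal products, substitutions and norms\<close>

lemma computes_matvec:
  assumes l: "l < length Bs" and B: "B = Bs ! l" "B \<in> carrier_mat n n" "has_shape B s"
    and x: "x \<in> carrier_vec n" "holds Bs m (\<lambda>i. x $ i) [0..<n] xs"
  shows "computes Bs m (bidiag_matvec n l s xs) (3 * n)
    (\<lambda>m'. holds Bs m' (\<lambda>i. (abs_mat B *\<^sub>v x) $ i) [0..<n])"
proof -
  have row: "computes Bs m' (matvec_row n l s xs i) 3
      (\<lambda>m'' a. operand_val Bs m'' a = Some ((abs_mat B *\<^sub>v x) $ i))"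
    if i: "i < n" and hm: "holds Bs m' (\<lambda>i. x $ i) [0..<n] xs" for i m'
  proof -
    have A: "abs_mat B \<in> carrier_mat n n" using B by (simp add: abs_mat_def)
    have e: "(abs_mat B *\<^sub>v x) $ i = \<bar>B $$ (i, i)\<bar> * x $ i +
        (case off_diag n s i of None \<Rightarrow> 0 | Some j \<Rightarrow> \<bar>B $$ (i, j)\<bar> * x $ j)"
      using bidiagonal_mult_vec[OF A has_shape_abs_mat[OF B(2,3)] x(1) i]
        B(2) i off_diagD[of n s i]
      by (auto simp: abs_mat_def split: option.splits)
    have entry: "operand_val Bs m'' (Entry l i j) = Some (B $$ (i, j))" if "j < n" for m'' j
      using l B i that by simp
    note hx = holds_nth[OF holds_append[OF hm]] holds_nth[OF holds_append[OF holds_append[OF hm]]]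
      holds_nth[OF holds_append[OF holds_append[OF holds_append[OF hm]]]]
    show ?thesis
    proof (cases "off_diag n s i")
      case None
      show ?thesis unfolding matvec_row_def None option.case
        apply (rule computes_emit_bind[where v = "\<bar>B $$ (i, i)\<bar>" and k = 3])
          apply (simp add: entry i del: operand_val.simps)
         apply (rule computes_emit_bind[where v = "\<bar>B $$ (i, i)\<bar> * x $ i" and k = 2])
           apply (simp add: hx i lift2_def del: operand_val.simps append_assoc)
          apply (rule computes_return)
        by (simp_all add: e None)
    next
      case (Some j)
      then have j: "j < n" using off_diagD i by blast
      show ?thesis unfolding matvec_row_def Some option.case
        apply (rule computes_emit_bind[where v = "\<bar>B $$ (i, i)\<bar>" and k = 3])
          apply (simp add: entry i del: operand_val.simps)
         apply (rule computes_emit_bind[where v = "\<bar>B $$ (i, i)\<bar> * x $ i" and k = 2])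
           apply (simp add: hx i lift2_def del: operand_val.simps append_assoc)
          apply (rule computes_emit_bind[where v = "\<bar>B $$ (i, j)\<bar>" and k = 2])
            apply (simp add: entry j del: operand_val.simps)
           apply (rule computes_emit_bind[where v = "\<bar>B $$ (i, j)\<bar> * x $ j" and k = 1])
             apply (simp add: hx j lift2_def del: operand_val.simps append_assoc)
            apply (rule computes_emit_last[where v = "(abs_mat B *\<^sub>v x) $ i"])
              apply (simp add: operand_val_append lift2_def e Some
                del: operand_val.simps append_assoc)
        by simp_all
    qed
  qed
  show ?thesis unfolding bidiag_matvec_def
    using computes_traverse_list[of "[0..<n]" Bs m "matvec_row n l s xs" 3
        "\<lambda>i. (abs_mat B *\<^sub>v x) $ i"] row holds_append[OF x(2)]
    by simp
qed

text \<open>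
  Later rows of a substitution. The order of the rows enters only through the last hypothesis, by
  which \<open>x\<close> solves each equation in terms of the unknown found just before, \<open>x j\<close> being the one found
  before the first row of \<open>is\<close>. In this form induction on \<open>is\<close> works for both shapes.
\<close>

lemma computes_subst_rows:
  assumes l: "l < length Bs" and B: "B = Bs ! l" "B \<in> carrier_mat n n"
    and "set is \<subseteq> {..<n}" "j < n" "\<And>i. i < n \<Longrightarrow> B $$ (i, i) \<noteq> 0"
    and "holds Bs m f [0..<n] ys" "operand_val Bs m z = Some (x j)"
    and "\<And>k. k < length is \<Longrightarrow> \<bar>B $$ (is ! k, is ! k)\<bar> * x (is ! k) =
      f (is ! k) + \<bar>B $$ (is ! k, (j # is) ! k)\<bar> * x ((j # is) ! k)"
  shows "computes Bs m (subst_rows l ys (Some (j, z)) is) (3 * length is)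
    (\<lambda>m'. holds Bs m' x is)"
  using assms(4-)
proof (induction "is" arbitrary: j z m)
  case Nil
  then show ?case by (auto simp: holds_def intro: computes_return)
next
  case (Cons i "is")
  have i: "i < n" using Cons.prems by simp
  have entry: "operand_val Bs m'' (Entry l i j) = Some (B $$ (i, j))" if "j < n" for m'' j
    using l B i that by simp
  have xi: "\<bar>B $$ (i, i)\<bar> * x i = f i + \<bar>B $$ (i, j)\<bar> * x j"
    using Cons.prems(6)[of 0] by simp
  have rec: "\<bar>B $$ (is ! k, is ! k)\<bar> * x (is ! k) =
      f (is ! k) + \<bar>B $$ (is ! k, (i # is) ! k)\<bar> * x ((i # is) ! k)" if "k < length is" for k
    using Cons.prems(6)[of "Suc k"] that by simp
  have d: "B $$ (i, i) \<noteq> 0" using Cons.prems i by blast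
  note hf = Cons.prems(4)
  note hy = holds_nth[OF hf] holds_nth[OF holds_append[OF hf]]
    holds_nth[OF holds_append[OF holds_append[OF hf]]]
  show ?case
    unfolding subst_rows.simps option.case prod.case bind_assoc
    apply (rule computes_emit_bind[where v = "\<bar>B $$ (i, j)\<bar>" and k = "3 * length is + 3"])
      apply (simp add: entry Cons.prems(2) del: operand_val.simps)
     apply (rule computes_emit_bind[where v = "\<bar>B $$ (i, j)\<bar> * x j" and k = "3 * length is + 2"])
       apply (simp add: Cons.prems(5) operand_val_append lift2_def del: operand_val.simps append_assoc)
      apply (rule computes_emit_bind[where v = "\<bar>B $$ (i, i)\<bar> * x i" and k = "3 * length is + 1"])
        apply (simp add: hy i xi lift2_def del: operand_val.simps append_assoc)
       apply (rule computes_emit_bind[where v = "\<bar>B $$ (i, i)\<bar>" and k = "3 * length is + 1"])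
         apply (simp add: entry i del: operand_val.simps)
        apply (rule computes_emit_bind[where v = "x i" and k = "3 * length is"])
          apply (simp add: operand_val_append lift2_def d del: operand_val.simps append_assoc)
         apply (rule computes_bind[OF Cons.IH computes_return[where k = 0]])
    using Cons.prems rec hf
    by (auto simp: i holds_append holds_def[of _ _ x] operand_val_append
        simp del: operand_val.simps append_assoc)
qed

text \<open>The first row has no off-diagonal term: its single flop is the division.\<close>

lemma computes_subst_rows_start:
  assumes l: "l < length Bs" and B: "B = Bs ! l" "B \<in> carrier_mat n n"
    and "set (i # is) \<subseteq> {..<n}" "\<And>i. i < n \<Longrightarrow> B $$ (i, i) \<noteq> 0"
    and hf: "holds Bs m f [0..<n] ys" 
    and x: "\<bar>B $$ (i, i)\<bar> * x i = f i"
      "\<And>k. k < length is \<Longrightarrow> \<bar>B $$ (is ! k, is ! k)\<bar> * x (is ! k) =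
        f (is ! k) + \<bar>B $$ (is ! k, (i # is) ! k)\<bar> * x ((i # is) ! k)"
  shows "computes Bs m (subst_rows l ys None (i # is)) (3 * length is + 1)
    (\<lambda>m'. holds Bs m' x (i # is))"
proof -
  have i: "i < n" using assms by simp
  have d: "B $$ (i, i) \<noteq> 0" using assms i by blast
  have entry: "operand_val Bs m'' (Entry l i i) = Some (B $$ (i, i))" for m''
    using l B i by simp
  show ?thesis
    unfolding subst_rows.simps option.case bind_left_identity
    apply (rule computes_emit_bind[where v = "\<bar>B $$ (i, i)\<bar>" and k = "3 * length is + 1"])
      apply (simp add: entry del: operand_val.simps)
     apply (rule computes_emit_bind[where v = "x i" and k = "3 * length is"])
       apply (simp add: holds_nth[OF holds_append[OF hf]] i lift2_def d flip: x(1)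
        del: operand_val.simps append_assoc)
      apply (rule computes_bind[OF computes_subst_rows[OF l B, where x = x and f = f]
          computes_return[where k = 0]])
    using assms(4,5) hf x(2)
    by (auto simp: i holds_append holds_def[of _ _ x] operand_val_append
        simp del: operand_val.simps append_assoc)
qed

lemma (in bidiagonal) computes_subst:
  assumes l: "l < length Bs" "B = Bs ! l" and n: "0 < n"
    and y: "y \<in> carrier_vec n" "holds Bs m (\<lambda>i. y $ i) [0..<n] ys"
  shows "computes Bs m (bidiag_subst n l s ys) (3 * n - 2)
    (\<lambda>m'. holds Bs m' (\<lambda>i. (mat_inv (comparison_mat B) *\<^sub>v y) $ i) [0..<n])"
proof -
  define x where "x = mat_inv (comparison_mat B) *\<^sub>v y"
  have x: "x \<in> carrier_vec n"
    unfolding x_def using comparison_inv(1) y(1) by (rule mult_mat_vec_carrier)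
  have "comparison_mat B *\<^sub>v x = y"
    unfolding x_def using comparison_carrier comparison_inv y
    by (simp flip: assoc_mult_mat_vec)
  then have sys: "\<bar>B $$ (i, i)\<bar> * x $ i = y $ i +
      (case off_diag n s i of None \<Rightarrow> 0 | Some j \<Rightarrow> \<bar>B $$ (i, j)\<bar> * x $ j)" if "i < n" for i
    using comparison_system[OF x that] by simp
  show ?thesis
  proof (cases s)
    case Lower
    have "computes Bs m (subst_rows l ys None (0 # [1..<n])) (3 * length [1..<n] + 1)
        (\<lambda>m'. holds Bs m' (\<lambda>i. x $ i) (0 # [1..<n]))"
    proof (rule computes_subst_rows_start[OF l carrier _ diag y(2)])
      show "\<bar>B $$ (0, 0)\<bar> * x $ 0 = y $ 0" using sys[OF n] Lower by simp
      fix k assume k: "k < length [1..<n]"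
      then have "(0 # [1..<n]) ! k = k" by (cases k) auto
      then show "\<bar>B $$ ([1..<n] ! k, [1..<n] ! k)\<bar> * x $ ([1..<n] ! k) = y $ ([1..<n] ! k) +
          \<bar>B $$ ([1..<n] ! k, (0 # [1..<n]) ! k)\<bar> * x $ ((0 # [1..<n]) ! k)"
        using sys[of "Suc k"] k Lower by simp
    qed (use n in auto)
    moreover have "0 # [1..<n] = [0..<n]" using n by (simp add: upt_conv_Cons)
    moreover have "3 * length [1..<n] + 1 = 3 * n - 2" using n by auto
    ultimately show ?thesis
      unfolding Lower bidiag_subst.simps x_def[symmetric] by (simp only:)
  next
    case Upper
    obtain p where p: "n = Suc p" using n by (cases n) auto
    \<comment> \<open>row \<open>p = n - 1\<close> comes first, and position \<open>k\<close> of the remaining rows is row \<open>p - Suc k\<close>\<close>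
    have rev_n: "rev [0..<n] = p # rev [0..<p]" by (simp add: p)
    have "computes Bs m (subst_rows l ys None (rev [0..<n])) (3 * length (rev [0..<p]) + 1)
        (\<lambda>m'. holds Bs m' (\<lambda>i. x $ i) (rev [0..<n]))"
      unfolding rev_n
    proof (rule computes_subst_rows_start[OF l carrier _ diag y(2)])
      show "\<bar>B $$ (p, p)\<bar> * x $ p = y $ p" using sys[of p] Upper p by simp
      fix k assume k: "k < length (rev [0..<p])"
      then have "(p # rev [0..<p]) ! k = p - k" by (cases k) (auto simp: rev_nth)
      then show "\<bar>B $$ (rev [0..<p] ! k, rev [0..<p] ! k)\<bar> * x $ (rev [0..<p] ! k) =
          y $ (rev [0..<p] ! k) +
          \<bar>B $$ (rev [0..<p] ! k, (p # rev [0..<p]) ! k)\<bar> * x $ ((p # rev [0..<p]) ! k)"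
        using sys[of "p - Suc k"] k Upper p by (simp add: rev_nth Suc_diff_Suc)
    qed (use p in auto)
    then show ?thesis
      unfolding Upper bidiag_subst.simps x_def[symmetric]
      by (rule computes_bind[OF _ computes_return[where k = 0]])
        (simp only: holds_def list_all2_rev1, simp add: p)
  qed
qed

text \<open>
  The program names factors by their position in \<open>Bs\<close>, so the induction runs over the suffixes \<open>Cs\<close>
  of \<open>Bs\<close>; the positions in \<open>Cs\<close> are shifted by the length of the prefix \<open>As\<close>.
\<close>

lemma computes_matvec_chain:
  assumes "list_all2 has_shape Cs sh" "\<And>C. C \<in> set Cs \<Longrightarrow> C \<in> carrier_mat n n"
    and "Bs = As @ Cs" "x \<in> carrier_vec n" "holds Bs m (\<lambda>i. x $ i) [0..<n] xs"
  shows "computes Bs m (matvec_chain n (List.enumerate (length As) sh) xs) (3 * n * length Cs)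
    (\<lambda>m'. holds Bs m' (\<lambda>i. (mat_prod n (map abs_mat Cs) *\<^sub>v x) $ i) [0..<n])"
  using assms
proof (induction Cs sh arbitrary: As rule: list_all2_induct)
  case Nil
  then show ?case by (auto intro!: computes_return)
next
  case (Cons C Cs s sh)
  let ?y = "mat_prod n (map abs_mat Cs) *\<^sub>v x"
  have P: "mat_prod n (map abs_mat Cs) \<in> carrier_mat n n"
    using Cons.prems by (intro mat_prod_carrier) (auto simp: abs_mat_def)
  have y: "?y \<in> carrier_vec n" using P Cons.prems(3) by (rule mult_mat_vec_carrier)
  have C: "C \<in> carrier_mat n n" "abs_mat C \<in> carrier_mat n n"
    using Cons.prems by (auto simp: abs_mat_def)
  have "mat_prod n (map abs_mat (C # Cs)) *\<^sub>v x = abs_mat C *\<^sub>v ?y"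
    using C P Cons.prems(3) by (simp add: assoc_mult_mat_vec)
  moreover have "computes Bs m (matvec_chain n (List.enumerate (Suc (length As)) sh) xs)
      (3 * n * length Cs) (\<lambda>m'. holds Bs m' (\<lambda>i. ?y $ i) [0..<n])"
    using Cons.IH[of "As @ [C]"] Cons.prems by simp
  ultimately show ?case
    using C y Cons.hyps Cons.prems(2)
    by (auto intro!: computes_bind computes_matvec[where x = ?y] simp del: append_assoc)
qed

lemma computes_subst_chain:
  assumes "list_all2 has_shape Cs sh"
    and "\<And>C. C \<in> set Cs \<Longrightarrow> C \<in> carrier_mat n n \<and> invertible_mat C"
    and "Bs = As @ Cs" "x \<in> carrier_vec n" "holds Bs m (\<lambda>i. x $ i) [0..<n] xs" "0 < n"
  shows "computes Bs m (subst_chain n (List.enumerate (length As) sh) xs)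
    ((3 * n - 2) * length Cs)
    (\<lambda>m'. holds Bs m' (\<lambda>i. (mat_prod n (map (\<lambda>C. mat_inv (comparison_mat C)) (rev Cs)) *\<^sub>v x) $ i)
      [0..<n])"
  using assms
proof (induction Cs sh arbitrary: As x xs m rule: list_all2_induct)
  case Nil
  then show ?case by (auto intro!: computes_return)
next
  case (Cons C Cs s sh)
  interpret bidiagonal n C s
    using Cons.prems Cons.hyps by unfold_locales auto
  let ?inv = "\<lambda>C. mat_inv (comparison_mat C)"
  let ?y = "?inv C *\<^sub>v x"
  have car: "D \<in> carrier_mat n n" if D: "D \<in> set (map ?inv (rev Cs))" for D
  proof -
    obtain E where E: "E \<in> set Cs" "D = ?inv E" using D by auto
    then obtain s' where "has_shape E s'"
      using ex_has_shape Cons.hyps(2) by blast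
    then interpret E: bidiagonal n E s'
      using E Cons.prems by unfold_locales auto
    show ?thesis using E.comparison_inv(1) E by simp
  qed
  have P: "mat_prod n (map ?inv (rev Cs)) \<in> carrier_mat n n"
    using car by (rule mat_prod_carrier)
  have y: "?y \<in> carrier_vec n" using comparison_inv(1) Cons.prems(3) by (rule mult_mat_vec_carrier)
  have "mat_prod n (map ?inv (rev Cs) @ [?inv C]) = mat_prod n (map ?inv (rev Cs)) * ?inv C"
    using car comparison_inv(1) by (rule mat_prod_snoc)
  then have e: "mat_prod n (map ?inv (rev (C # Cs))) *\<^sub>v x = mat_prod n (map ?inv (rev Cs)) *\<^sub>v ?y"
    using assoc_mult_mat_vec[OF P comparison_inv(1) Cons.prems(3)] by simp
  have 1: "computes Bs m (bidiag_subst n (length As) s xs) (3 * n - 2)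
      (\<lambda>m'. holds Bs m' (\<lambda>i. ?y $ i) [0..<n])"
    using Cons.prems by (intro computes_subst) auto
  have 2: "computes Bs m' (subst_chain n (List.enumerate (Suc (length As)) sh) ys)
      ((3 * n - 2) * length Cs)
      (\<lambda>m'. holds Bs m' (\<lambda>i. (mat_prod n (map ?inv (rev Cs)) *\<^sub>v ?y) $ i) [0..<n])"
    if "holds Bs m' (\<lambda>i. ?y $ i) [0..<n] ys" for m' ys
    using Cons.IH[of "As @ [C]" ?y m' ys] Cons.prems y that by simp
  show ?case
    unfolding e enumerate_simps subst_chain.simps
    by (rule computes_bind[OF 1 2]) auto
qed

text \<open>
  The element \<open>0\<close> comes from the start value of the loop; it does not change the maximum of absolute
  values over a nonempty index set.
\<close>

lemma computes_norm:
  assumes "holds Bs m f is xs"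
  shows "computes Bs m (norm_gen xs) 0
    (\<lambda>m' a. operand_val Bs m' a = Some (Max (insert 0 ((\<lambda>i. \<bar>f i\<bar>) ` set is))))"
  using assms
proof (induction xs arbitrary: "is" m)
  case Nil
  then show ?case by (auto simp: holds_def intro!: computes_return)
next
  case (Cons x xs)
  then obtain i js where "is": "is = i # js"
      and x: "operand_val Bs m x = Some (f i)" and xs: "holds Bs m f js xs"
    by (auto simp: holds_def list_all2_Cons2)
  have e: "Max (insert 0 ((\<lambda>i. \<bar>f i\<bar>) ` set is)) =
      max \<bar>f i\<bar> (Max (insert 0 ((\<lambda>i. \<bar>f i\<bar>) ` set js)))"
    unfolding "is" by (simp add: insert_commute[of 0])
  show ?case unfolding norm_gen.simps
    apply (rule computes_emit_bind[where v = "\<bar>f i\<bar>" and k = 0])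
      apply (simp add: x)
     apply (rule computes_bind[OF Cons.IH[OF holds_append[OF xs]], where k' = 0])
      apply (rule computes_emit_last)
        apply (simp add: operand_val_append lift2_def del: operand_val.simps append_assoc)
       apply simp
      apply (simp add: e)
    by simp_all
qed

lemma Max_abs_eq_vec_norm_inf:
  assumes "x \<in> carrier_vec n" "0 < n"
  shows "Max (insert 0 ((\<lambda>i. \<bar>x $ i\<bar>) ` set [0..<n])) = vec_norm_inf x"
proof -
  have "0 \<le> vec_norm_inf x"
    using vec_norm_inf_ge[of 0 x] assms by (auto intro: order_trans[OF abs_ge_zero])
  then show ?thesis using assms
    by (subst Max_insert) (auto simp: vec_norm_inf_def lessThan_atLeast0)
qed

text \<open>
  With \<open>3n\<close> flops for each product, \<open>3n - 2\<close> for each substitution and one for the final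
  multiplication, the total is \<open>6kn - 2k + 1\<close>, which is at most \<open>6kn\<close> because \<open>k \<ge> 1\<close>.
\<close>

lemma computes_cond_gen:
  assumes sh: "list_all2 has_shape Bs sh"
    and Bs: "\<And>B. B \<in> set Bs \<Longrightarrow> B \<in> carrier_mat n n \<and> invertible_mat B"
    and n: "0 < n" and ne: "Bs \<noteq> []"
    and p: "p = vec_norm_inf (mat_prod n (map abs_mat Bs) *\<^sub>v ones_vec n)"
    and q: "q = vec_norm_inf
      (mat_prod n (map (\<lambda>B. mat_inv (comparison_mat B)) (rev Bs)) *\<^sub>v ones_vec n)"
  shows "computes Bs [] (cond_gen n sh) (6 * length Bs * n) (\<lambda>m (a, b, c).
    operand_val Bs m a = Some p \<and> operand_val Bs m b = Some q \<and>
    operand_val Bs m c = Some (p * q))"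
proof -
  let ?x = "mat_prod n (map abs_mat Bs) *\<^sub>v ones_vec n"
  let ?y = "mat_prod n (map (\<lambda>B. mat_inv (comparison_mat B)) (rev Bs)) *\<^sub>v ones_vec n"
  let ?e = "replicate n (Const 1)"
  have e: "ones_vec n \<in> carrier_vec n" "holds Bs m (\<lambda>i. ones_vec n $ i) [0..<n] ?e" for m
    by (auto simp: ones_vec_def holds_def list_all2_conv_all_nth)
  have inv: "mat_inv (comparison_mat B) \<in> carrier_mat n n" if B: "B \<in> set Bs" for B
  proof -
    obtain s where "has_shape B s"
      using ex_has_shape[OF sh B] by blast
    then interpret bidiagonal n B s using Bs B by unfold_locales auto
    show ?thesis by (rule comparison_inv(1))
  qed
  have x: "?x \<in> carrier_vec n"
    by (rule mult_mat_vec_carrier[OF mat_prod_carrier e(1)]) (use Bs in \<open>auto simp: abs_mat_def\<close>)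
  have y: "?y \<in> carrier_vec n"
    by (rule mult_mat_vec_carrier[OF mat_prod_carrier e(1)]) (use inv in auto)
  have 1: "computes Bs m (matvec_chain n (List.enumerate 0 sh) ?e) (3 * n * length Bs)
      (\<lambda>m'. holds Bs m' (\<lambda>i. ?x $ i) [0..<n])" for m
    using computes_matvec_chain[where As = "[]" and Bs = Bs, OF sh _ _ e] Bs by simp
  have 2: "computes Bs m (subst_chain n (List.enumerate 0 sh) ?e) ((3 * n - 2) * length Bs)
      (\<lambda>m'. holds Bs m' (\<lambda>i. ?y $ i) [0..<n])" for m
    using computes_subst_chain[where As = "[]" and Bs = Bs, OF sh _ _ e n] Bs by simp
  have norm_x: "computes Bs m (norm_gen xs) 0 (\<lambda>m' a. operand_val Bs m' a = Some p)"
    if "holds Bs m (\<lambda>i. ?x $ i) [0..<n] xs" for m xs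
    using computes_norm[OF that] by (simp only: Max_abs_eq_vec_norm_inf[OF x n] p)
  have norm_y: "computes Bs m (norm_gen xs) 0 (\<lambda>m' a. operand_val Bs m' a = Some q)"
    if "holds Bs m (\<lambda>i. ?y $ i) [0..<n] xs" for m xs
    using computes_norm[OF that] by (simp only: Max_abs_eq_vec_norm_inf[OF y n] q)
  have "3 * n * length Bs + ((3 * n - 2) * length Bs + 1) \<le> 6 * length Bs * n"
  proof -
    have "3 * n - 2 + 2 = 3 * n" using n by simp
    then have "(3 * n - 2) * length Bs + 2 * length Bs = 3 * n * length Bs"
      by (metis distrib_right)
    moreover have "0 < length Bs" using ne by simp
    moreover have "6 * length Bs * n = 3 * n * length Bs + 3 * n * length Bs" by simp
    ultimately show ?thesis by linarith
  qed
  then show ?thesis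
    unfolding cond_gen_def Let_def
    apply (intro computes_bind[OF 1, where k' = "(3 * n - 2) * length Bs + 1"])
     apply (rule computes_bind[OF norm_x, where k' = "(3 * n - 2) * length Bs + 1"])
       apply assumption
      apply (rule computes_bind[OF 2, where k' = 1])
       apply (rule computes_bind[OF norm_y, where k' = 1])
         apply assumption
        apply (rule computes_emit_bind[where v = "p * q" and k = 0])
          apply (simp add: operand_val_append lift2_def del: operand_val.simps append_assoc)
         apply (rule computes_return)
    by (auto simp: operand_val_append simp del: operand_val.simps append_assoc)
qed


section \<open>The condition number of a product\<close>

theorem mainTheorem2:
  fixes n :: nat and Bs :: "real mat list"
  assumes "0 < n" and "Bs \<noteq> []"
    and "\<forall>B \<in> set Bs. B \<in> carrier_mat n n"
    and "\<forall>B \<in> set Bs. invertible_mat B"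
    and "\<forall>B \<in> set Bs. upper_bidiagonal B \<or> lower_bidiagonal B"
    and "(\<forall>B \<in> set Bs. nonneg_mat B) \<or> (\<forall>B \<in> set Bs. checkerboard B)"
  shows
    "mat_norm_inf (mat_prod n Bs) =
       vec_norm_inf (mat_prod n (map abs_mat Bs) *\<^sub>v ones_vec n) \<and>
     mat_norm_inf (mat_prod n (map mat_inv (rev Bs))) =
       vec_norm_inf
         (mat_prod n (map (\<lambda>B. mat_inv (comparison_mat B)) (rev Bs)) *\<^sub>v ones_vec n) \<and>
     (\<forall>sh. list_all2 has_shape Bs sh \<longrightarrow>
       (\<exists>p q r P m.
         run_state (cond_gen n sh) [] = ((p, q, r), P) \<and>
         exec Bs P [] = Some m \<and>
         operand_val Bs m p =
           Some (vec_norm_inf (mat_prod n (map abs_mat Bs) *\<^sub>v ones_vec n)) \<and>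
         operand_val Bs m q =
           Some (vec_norm_inf
             (mat_prod n (map (\<lambda>B. mat_inv (comparison_mat B)) (rev Bs)) *\<^sub>v ones_vec n)) \<and>
         operand_val Bs m r = Some (cond_inf (mat_prod n Bs)) \<and>
         flops P \<le> 6 * length Bs * n))"
proof -
  let ?p = "vec_norm_inf (mat_prod n (map abs_mat Bs) *\<^sub>v ones_vec n)"
  let ?inv = "\<lambda>B. mat_inv (comparison_mat B)"
  let ?q = "vec_norm_inf (mat_prod n (map ?inv (rev Bs)) *\<^sub>v ones_vec n)"
  obtain t where t: "\<bar>t\<bar> = (1 :: real)"
    and scale: "\<And>B. B \<in> set Bs \<Longrightarrow> \<exists>c. \<bar>c\<bar> = 1 \<and> B = scale c t (abs_mat B)"
    using assms(6)
  proof
    assume "\<forall>B \<in> set Bs. nonneg_mat B"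
    then show thesis using nonneg_eq_scale that[of 1] by (metis abs_one)
  next
    assume "\<forall>B \<in> set Bs. checkerboard B"
    then show thesis using checkerboard_eq_scale assms(3) that[of "- 1"]
      by (metis abs_minus_cancel abs_one)
  qed
  have bidiag: "\<exists>s. bidiagonal n B s" if "B \<in> set Bs" for B
    using assms(3-5) that has_shape.simps unfolding bidiagonal_def by metis
  have abs_carrier: "abs_mat B \<in> carrier_mat n n" if "B \<in> set Bs" for B
    using assms(3) that by (simp add: abs_mat_def)
  have inv_carrier: "?inv B \<in> carrier_mat n n" if "B \<in> set Bs" for B
    using bidiag[OF that] bidiagonal.comparison_inv(1) by blast
  have inv_nonneg: "nonneg_mat (?inv B)" if "B \<in> set Bs" for B
    using bidiag[OF that] bidiagonal.comparison_inv_nonneg by blast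
  have "\<exists>s. \<bar>s\<bar> = 1 \<and> mat_prod n (map (\<lambda>B. B) Bs) = scale s t (mat_prod n (map abs_mat Bs))"
    using abs_carrier scale by (intro mat_prod_scale[OF t]) auto
  moreover have "mat_prod n (map abs_mat Bs) \<in> carrier_mat n n"
    using abs_carrier by (intro mat_prod_carrier) auto
  moreover have "nonneg_mat (mat_prod n (map abs_mat Bs))"
    using abs_carrier by (intro nonneg_mat_prod) (auto simp: nonneg_mat_def abs_mat_def)
  ultimately have norm: "mat_norm_inf (mat_prod n Bs) = ?p"
    using mat_norm_inf_scale[OF _ t _ _ assms(1)] by auto
  have "\<exists>s. \<bar>s\<bar> = 1 \<and>
      mat_prod n (map mat_inv (rev Bs)) = scale s (- t) (mat_prod n (map ?inv (rev Bs)))"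
    using inv_carrier scale bidiag t bidiagonal.mat_inv_eq_scale
    by (intro mat_prod_scale) (simp, metis set_rev)
  moreover have "mat_prod n (map ?inv (rev Bs)) \<in> carrier_mat n n"
    using inv_carrier by (intro mat_prod_carrier) auto
  moreover have "nonneg_mat (mat_prod n (map ?inv (rev Bs)))"
    using inv_carrier inv_nonneg by (intro nonneg_mat_prod) auto
  ultimately have norm_inv: "mat_norm_inf (mat_prod n (map mat_inv (rev Bs))) = ?q"
    using mat_norm_inf_scale[of _ "- t", OF _ _ _ _ assms(1)] t by auto
  have cond: "cond_inf (mat_prod n Bs) = ?p * ?q"
    using mat_inv_mat_prod[of Bs n] assms(3,4) norm norm_inv by (simp add: cond_inf_def)
  have "\<exists>p q r P m. run_state (cond_gen n sh) [] = ((p, q, r), P) \<and> exec Bs P [] = Some m \<and>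
      operand_val Bs m p = Some ?p \<and> operand_val Bs m q = Some ?q \<and>
      operand_val Bs m r = Some (?p * ?q) \<and> flops P \<le> 6 * length Bs * n"
    if sh: "list_all2 has_shape Bs sh" for sh
  proof -
    have "computes Bs [] (cond_gen n sh) (6 * length Bs * n) (\<lambda>m (a, b, c).
        operand_val Bs m a = Some ?p \<and> operand_val Bs m b = Some ?q \<and>
        operand_val Bs m c = Some (?p * ?q))"
      using assms(3,4) by (intro computes_cond_gen[OF sh _ assms(1,2) refl refl]) auto
    moreover have "exec Bs [] [] = Some []" "flops [] = 0" by (simp_all add: flops_def)
    ultimately obtain a P m where "run_state (cond_gen n sh) [] = (a, P)"
        "exec Bs P [] = Some m" "flops P \<le> 6 * length Bs * n"
        "case a of (a, b, c) \<Rightarrow> operand_val Bs m a = Some ?p \<and> operand_val Bs m b = Some ?q \<and>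
          operand_val Bs m c = Some (?p * ?q)"
      unfolding computes_def by (metis add_0 append_Nil)
    then show ?thesis by (cases a) auto
  qed
  then show ?thesis using norm norm_inv cond by simp
qed

end
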